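(* Let $\xi>0$ and put $\sigma:=\dfrac{2\mu+2\nu+3}{2\xi}$. Then $$\int_0^\infty x^\mu e^{-ax^\xi}\sqrt{xy}\,J_\nu(xy)\,dx=\frac{y^{\nu+1/2}}{2^\nu\,\xi\, a^\sigma}\;{}_1\Psi_1\left[\begin{array}{c}(\sigma,2/\xi)\\(\nu+1,1)\end{array}\Big|\,-\frac{y^2}{4a^{2/\xi}}\right],$$ where $a>0$, $y>0$ and $\Re(\mu+\nu)>-\tfrac12$.
   Context: $J_\nu$ is the Bessel function of the first kind, $J_\nu(z)=(z/2)^\nu\sum_{k=0}^\infty\frac{(-1)^k(z/2)^{2k}}{k!\,\Gamma(\nu+1+k)}$. The Fox–Wright function is $${}_p\Psi_q\left[\begin{array}{c}(\alpha_1,A_1),\ldots,(\alpha_p,A_p)\\(\beta_1,B_1),\ldots,(\beta_q,B_q)\end{array}\Big|\,z\right]=\sum_{k=0}^\infty\frac{\Gamma(\alpha_1+kA_1)\cdots\Gamma(\alpha_p+kA_p)}{\Gamma(\beta_1+kB_1)\cdots\Gamma(\beta_q+kB_q)}\,\frac{z^k}{k!},$$ where $z,\alpha_j,\beta_j\in\mathbb{C}$ and $A_j,B_j\ge0$, it being supposed throughout that the parameters are such that the gamma functions are well defined. In particular $${}_1\Psi_1\left[\begin{array}{c}(\sigma,2/\xi)\\(\nu+1,1)\end{array}\Big|\,z\right]=\sum_{k=0}^\infty\frac{\Gamma(\sigma+2k/\xi)}{\Gamma(\nu+1+k)}\frac{z^k}{k!}.$$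
   Formalization: The equation is stated only where the series defining the Fox–Wright function converges (it diverges for ξ<1, and for ξ=1 with y>a, leaving the right-hand side undefined); absolute convergence of the integral is proved for all ξ>0. *)

theory Defs
  imports "HOL-Analysis.Analysis"
begin

text \<open>
  In both series below a denominator factor \<open>Gamma\<close> at a pole contributes a vanishing term: the
  library sets \<open>Gamma\<close> to 0 there and division by 0 yields 0, in agreement with the entire
  function \<open>1 / \<Gamma>\<close>. In particular, \<open>bessel_J\<close> is the usual function also for negative integer order.
\<close>

text \<open>
  Principal branch of \<open>(z / 2)\<^sup>\<nu>\<close>. The definition is meaningful for \<open>z \<noteq> 0\<close> only, since \<open>0 powr \<nu> = 0\<close>
  for every \<open>\<nu>\<close>, including \<open>\<nu> = 0\<close>.
\<close>

definition bessel_J :: "complex \<Rightarrow> complex \<Rightarrow> complex" where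
  "bessel_J \<nu> z = (z / 2) powr \<nu> *
     (\<Sum>k. (-1) ^ k * (z / 2) ^ (2 * k) / (fact k * Gamma (\<nu> + 1 + of_nat k)))"

text \<open>
  The lists hold the parameter pairs \<open>(\<alpha>\<^sub>j, A\<^sub>j)\<close> and \<open>(\<beta>\<^sub>j, B\<^sub>j)\<close>. The value of \<open>fox_wright\<close> is
  meaningful only where the series converges and no numerator \<open>Gamma\<close> is evaluated at a pole.
\<close>

definition fox_wright_term ::
    "(complex \<times> real) list \<Rightarrow> (complex \<times> real) list \<Rightarrow> complex \<Rightarrow> nat \<Rightarrow> complex" where
  "fox_wright_term ps qs z k =
     (\<Prod>(\<alpha>, A)\<leftarrow>ps. Gamma (\<alpha> + of_nat k * of_real A)) /
     (\<Prod>(\<beta>, B)\<leftarrow>qs. Gamma (\<beta> + of_nat k * of_real B)) * (z ^ k / fact k)"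

definition fox_wright ::
    "(complex \<times> real) list \<Rightarrow> (complex \<times> real) list \<Rightarrow> complex \<Rightarrow> complex" where
  "fox_wright ps qs z = (\<Sum>k. fox_wright_term ps qs z k)"

end

theory Submission
  imports Defs
begin

text \<open>
  For \<open>x > 0\<close> the Bessel function is \<open>(x y / 2) powr \<nu>\<close> times an entire function \<open>g = clifford \<nu>\<close> evaluated
  at \<open>x\<^sup>2 y\<^sup>2 / 4\<close>. The integrand is thus a constant times \<open>x powr p * exp (- a * x powr \<xi>) * g (b * x\<^sup>2)\<close>
  with \<open>p = \<mu> + \<nu> + 1/2\<close> and \<open>b = y\<^sup>2 / 4\<close>. Each monomial of \<open>g\<close> contributes a Gamma integral
  (\<open>stretched_Gamma_integral\<close>), and these contributions are the terms of the Fox-Wright series. Two points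
  need an argument.

  The integrand must be integrable for every \<open>\<xi> > 0\<close>, also where \<open>exp (- a * x powr \<xi>)\<close> decays more
  slowly than the majorant of the power series of \<open>g\<close> grows. The differential equation of \<open>g\<close> yields an
  energy identity, and this bounds \<open>g\<close> polynomially on the positive axis
  (\<open>clifford_polynomial_bound\<close>).

  The series may converge only conditionally, which can happen for \<open>\<xi> = 1\<close> when \<open>z\<close> lies on the circle of
  convergence. The argument of \<open>g\<close> is therefore scaled by a factor \<open>u < 1\<close>, which multiplies the \<open>k\<close>-th
  term by \<open>u ^ k\<close>. Terms of a convergent series are bounded, and the integrals of the absolute values of
  the summands exceed the absolute values of the terms by a bounded factor only
  (\<open>norm_Gamma_ratio_mono\<close>); so for \<open>u < 1\<close> summation and integration can be exchanged. Letting \<open>u\<close> tend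
  to 1, the integrals converge by dominated convergence and the series by Abel's theorem
  (\<open>Abel_limit\<close>). This is \<open>clifford_transform\<close>, and the theorem is its translation into
  \<open>bessel_J\<close> and \<open>fox_wright\<close>.
\<close>

section \<open>Abel's limit theorem\<close>

text \<open>
  Abel's theorem along an arbitrary sequence. With the tails \<open>r n = (\<Sum>k. c (k + n))\<close> one has
  \<open>c n = r n - r (Suc n)\<close>, and summation by parts gives
  \<open>(\<Sum>k. c k * t ^ k) - suminf c = - (1 - t) * (\<Sum>n. r (Suc n) * t ^ n)\<close>. Since \<open>r\<close> tends to 0, the
  right-hand side is at most a finite sum times \<open>1 - t\<close> plus a small multiple of
  \<open>(1 - t) * (\<Sum>n. t ^ n) = 1\<close>.
\<close>

lemma Abel_limit:
  fixes c :: "nat \<Rightarrow> 'a::{real_normed_field,banach}" and t :: "nat \<Rightarrow> real"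
  assumes c: "summable c" and t: "\<And>m. 0 \<le> t m" "\<And>m. t m < 1" and lim: "t \<longlonglongrightarrow> 1"
  shows "(\<lambda>m. \<Sum>k. c k * of_real (t m) ^ k) \<longlonglongrightarrow> suminf c"
proof -
  define r where "r n = (\<Sum>k. c (k + n))" for n
  have r_step: "c n = r n - r (Suc n)" for n
    using suminf_split_head[of "\<lambda>k. c (k + n)"] summable_ignore_initial_segment[OF c, of n]
    by (simp add: r_def)
  have r_lim: "r \<longlonglongrightarrow> 0"
    unfolding r_def by (rule suminf_exist_split2[OF c])
  then have "Bseq r" by (simp add: convergent_imp_Bseq convergentI)
  then obtain B where B: "B > 0" "\<And>n. norm (r n) \<le> B" by (auto elim: BseqE)
  have r_sum: "summable (\<lambda>n. norm (r (Suc n)) * t m ^ n)" for m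
    by (rule summable_comparison_test[of _ "\<lambda>n. B * t m ^ n"])
      (use t[of m] B in \<open>auto intro!: exI[of _ 0] mult_right_mono summable_mult summable_geometric\<close>)
  have err: "norm ((\<Sum>k. c k * of_real (t m) ^ k) - suminf c)
      \<le> (1 - t m) * (\<Sum>n. norm (r (Suc n)) * t m ^ n)" for m
  proof -
    let ?T = "of_real (t m) :: 'a"
    have s1: "summable (\<lambda>n. r (Suc n) * ?T ^ n)"
      by (rule summable_norm_cancel) (use r_sum[of m] t(1)[of m] in \<open>simp add: norm_mult norm_power\<close>)
    have s0: "summable (\<lambda>n. r n * ?T ^ n)"
      by (rule summable_comparison_test[of _ "\<lambda>n. B * t m ^ n"])
        (use t[of m] B in \<open>auto intro!: exI[of _ 0] mult_right_mono summable_mult summable_geometric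
           simp: norm_mult norm_power\<close>)
    have "(\<Sum>k. c k * ?T ^ k) = (\<Sum>k. r k * ?T ^ k - r (Suc k) * ?T ^ k)"
      by (simp add: r_step algebra_simps)
    also have "\<dots> = (\<Sum>k. r k * ?T ^ k) - (\<Sum>k. r (Suc k) * ?T ^ k)"
      by (rule suminf_diff[OF s0 s1, symmetric])
    also have "(\<Sum>k. r k * ?T ^ k) = r 0 + (\<Sum>k. ?T * (r (Suc k) * ?T ^ k))"
      using suminf_split_head[OF s0] by (simp add: algebra_simps)
    also have "(\<Sum>k. ?T * (r (Suc k) * ?T ^ k)) = ?T * (\<Sum>k. r (Suc k) * ?T ^ k)"
      by (rule suminf_mult[OF s1])
    finally have "(\<Sum>k. c k * ?T ^ k) - suminf c = - of_real (1 - t m) * (\<Sum>k. r (Suc k) * ?T ^ k)"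
      by (simp add: r_def algebra_simps)
    then have "norm ((\<Sum>k. c k * ?T ^ k) - suminf c) = (1 - t m) * norm (\<Sum>k. r (Suc k) * ?T ^ k)"
      using less_imp_le[OF t(2)[of m]] by (simp only: norm_mult norm_minus_cancel norm_of_real abs_of_nonneg diff_ge_0_iff_ge)
    also have "\<dots> \<le> (1 - t m) * (\<Sum>n. norm (r (Suc n)) * t m ^ n)"
      using summable_norm[of "\<lambda>n. r (Suc n) * ?T ^ n"] r_sum[of m] t[of m]
      by (intro mult_left_mono) (auto simp: norm_mult norm_power)
    finally show ?thesis .
  qed
  have "(\<lambda>m. (\<Sum>k. c k * of_real (t m) ^ k) - suminf c) \<longlonglongrightarrow> 0"
  proof (rule LIMSEQ_I)
    fix e :: real assume e: "0 < e"
    obtain N where N: "\<And>n. n \<ge> N \<Longrightarrow> norm (r n) < e / 2"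
      using LIMSEQ_D[OF r_lim, of "e/2"] e by auto
    have "(\<lambda>m. (1 - t m) * (B * real N)) \<longlonglongrightarrow> (1 - 1) * (B * real N)"
      by (intro tendsto_intros lim)
    then obtain M where M: "\<And>m. m \<ge> M \<Longrightarrow> norm ((1 - t m) * (B * real N)) < e / 2"
      using LIMSEQ_D[of "\<lambda>m. (1 - t m) * (B * real N)" 0 "e/2"] e by auto
    show "\<exists>no. \<forall>m\<ge>no. norm ((\<Sum>k. c k * of_real (t m) ^ k) - suminf c - 0) < e"
    proof (intro exI[of _ M] allI impI)
      fix m assume m: "M \<le> m"
      have geo: "(\<lambda>n. e / 2 * t m ^ n) sums (e / 2 * (1 / (1 - t m)))"
        using t[of m] by (intro sums_mult geometric_sums) auto
      have fin: "(\<lambda>n. if n < N then B else 0) sums (\<Sum>n<N. B)"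
        using sums_If_finite[of "\<lambda>n. n < N" "\<lambda>_. B"] by (simp add: lessThan_def)
      have bd: "norm (r (Suc n)) * t m ^ n \<le> (if n < N then B else 0) + e / 2 * t m ^ n" for n
      proof (cases "n < N")
        case True
        have "norm (r (Suc n)) * t m ^ n \<le> B * 1"
          using t[of m] B by (intro mult_mono power_le_one) auto
        then show ?thesis using True e t(1)[of m] by (simp add: add_increasing2)
      next
        case False
        then have "norm (r (Suc n)) * t m ^ n \<le> e / 2 * t m ^ n"
          using N[of "Suc n"] t(1)[of m] by (intro mult_right_mono) auto
        then show ?thesis using False by simp
      qed
      have "(\<Sum>n. norm (r (Suc n)) * t m ^ n) \<le> (\<Sum>n<N. B) + e / 2 * (1 / (1 - t m))"
        using sums_le[OF bd summable_sums[OF r_sum[of m]] sums_add[OF fin geo]] .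
      then have "(1 - t m) * (\<Sum>n. norm (r (Suc n)) * t m ^ n)
          \<le> (1 - t m) * ((\<Sum>n<N. B) + e / 2 * (1 / (1 - t m)))"
        using t[of m] by (intro mult_left_mono) auto
      also have "\<dots> = (1 - t m) * (B * real N) + e / 2"
        using t(2)[of m] by (simp add: field_simps)
      also have "\<dots> < e" using M[OF m] by auto
      finally show "norm ((\<Sum>k. c k * of_real (t m) ^ k) - suminf c - 0) < e"
        using err[of m] by simp
    qed
  qed
  then show ?thesis by (simp add: LIM_zero_iff)
qed

section \<open>The modulus of the Gamma function on horizontal lines\<close>

text \<open>
  The quotient \<open>\<bar>\<Gamma>(x + i y)\<bar> / \<Gamma>(x)\<close> increases with \<open>x > 0\<close>: in the limit formula of Gauss it is the
  product over \<open>j\<close> of \<open>(x + j) / \<bar>x + j + i y\<bar>\<close>, and each factor increases with \<open>x\<close>. Along a horizontal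
  line the modulus of \<open>\<Gamma>\<close> thus never falls below a fixed fraction of the value at the real part, so
  that a bound on terms containing \<open>\<Gamma>(\<sigma> + 2 k / \<xi>)\<close> carries over to the integrals of the absolute
  values, where \<open>\<Gamma>(Re \<sigma> + 2 k / \<xi>)\<close> appears.
\<close>

lemma norm_Gamma_ratio_mono:
  fixes x0 x y :: real
  assumes "0 < x0" "x0 \<le> x"
  shows "norm (Gamma (Complex x0 y)) * Gamma x \<le> norm (Gamma (Complex x y)) * Gamma x0"
proof (rule LIMSEQ_le)
  show "(\<lambda>n. norm (Gamma_series (Complex x0 y) n) * Gamma_series x n)
      \<longlonglongrightarrow> norm (Gamma (Complex x0 y)) * Gamma x"
    by (intro tendsto_intros Gamma_series_LIMSEQ)
  show "(\<lambda>n. norm (Gamma_series (Complex x y) n) * Gamma_series x0 n)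
      \<longlonglongrightarrow> norm (Gamma (Complex x y)) * Gamma x0"
    by (intro tendsto_intros Gamma_series_LIMSEQ)
  have ineq: "norm (pochhammer (Complex x y) n) * pochhammer x0 n
      \<le> norm (pochhammer (Complex x0 y) n) * pochhammer x n" for n
  proof -
    have fac: "norm (Complex x y + of_nat i) * (x0 + of_nat i)
        \<le> norm (Complex x0 y + of_nat i) * (x + of_nat i)" for i
    proof (rule power2_le_imp_le)
      have "(x0 + i)\<^sup>2 \<le> (x + i)\<^sup>2" using assms by (intro power_mono) auto
      then have "(((x + i)\<^sup>2 + y\<^sup>2) * (x0 + i)\<^sup>2) \<le> (((x0 + i)\<^sup>2 + y\<^sup>2) * (x + i)\<^sup>2)"
        by (simp add: algebra_simps mult_left_mono)
      then show "(norm (Complex x y + of_nat i) * (x0 + of_nat i))\<^sup>2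
          \<le> (norm (Complex x0 y + of_nat i) * (x + of_nat i))\<^sup>2"
        by (simp add: power_mult_distrib cmod_power2)
    qed (use assms in auto)
    show ?thesis
      unfolding pochhammer_prod prod_norm[symmetric] prod.distrib[symmetric]
      using fac assms by (intro prod_mono) auto
  qed
  show "\<exists>N. \<forall>n\<ge>N. norm (Gamma_series (Complex x0 y) n) * Gamma_series x n
      \<le> norm (Gamma_series (Complex x y) n) * Gamma_series x0 n"
  proof (intro exI allI impI)
    fix n
    have pos: "pochhammer x0 (n+1) > 0" "pochhammer x (n+1) > 0"
      using assms by (auto intro: pochhammer_pos)
    have "Complex u y + of_nat i \<noteq> 0" if "u > 0" for u i
      using that by (auto simp: complex_eq_iff)
    then have nz: "norm (pochhammer (Complex u y) (n+1)) > 0" if "u > 0" for u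
      using that by (auto simp: pochhammer_prod)
    note nz0 = nz[OF assms(1)] and nz1 = nz[of x]
    show "norm (Gamma_series (Complex x0 y) n) * Gamma_series x n
      \<le> norm (Gamma_series (Complex x y) n) * Gamma_series x0 n"
      using ineq[of "n+1"] pos nz0 nz1 assms unfolding Gamma_series_def
      by (simp add: norm_mult norm_divide divide_simps mult_ac)
  qed
qed

section \<open>The Bessel-Clifford function\<close>

definition clifford_coeff :: "complex \<Rightarrow> nat \<Rightarrow> complex" where
  "clifford_coeff \<nu> k = (-1) ^ k * rGamma (\<nu> + 1 + of_nat k) / fact k"

text \<open>
  The entire function \<open>s \<mapsto> C\<^sub>\<nu>(-s)\<close>, where \<open>C\<^sub>\<nu>\<close> is the Bessel-Clifford function. It is the part of
  \<open>bessel_J\<close> without branch point. The coefficients are written with \<open>rGamma\<close>, whose functional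
  equation holds at the poles of \<open>Gamma\<close> as well, so that negative integer orders need no separate
  treatment.
\<close>

definition clifford :: "complex \<Rightarrow> complex \<Rightarrow> complex" where
  "clifford \<nu> s = (\<Sum>k. clifford_coeff \<nu> k * s ^ k)"

lemma clifford_coeff_shift: "of_nat (Suc k) * clifford_coeff \<nu> (Suc k) = - clifford_coeff (\<nu> + 1) k"
proof -
  have *: "\<nu> + 1 + of_nat (Suc k) = \<nu> + 1 + 1 + of_nat k" by simp
  show ?thesis unfolding clifford_coeff_def * by (simp add: divide_simps del: of_nat_Suc)
qed

lemma clifford_coeff_Suc:
  "of_nat (Suc k) * (\<nu> + 1 + of_nat k) * clifford_coeff \<nu> (Suc k) = - clifford_coeff \<nu> k"
proof -
  have *: "\<nu> + 1 + of_nat (Suc k) = \<nu> + 1 + of_nat k + 1" by simp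
  show ?thesis using rGamma_plus1[of "\<nu> + 1 + of_nat k"]
    unfolding clifford_coeff_def * by (simp add: divide_simps del: of_nat_Suc)
qed

lemma summable_clifford: "summable (\<lambda>k. clifford_coeff \<nu> k * s ^ k)"
proof -
  obtain N :: nat where N: "real N > 2 + norm (\<nu> + 1) + 2 * norm s"
    using reals_Archimedean2 by blast
  show ?thesis
  proof (rule summable_ratio_test)
    fix n assume n: "N \<le> n"
    have "norm (of_nat n :: complex) \<le> norm (\<nu> + 1 + of_nat n) + norm (\<nu> + 1)"
      using norm_triangle_ineq4[of "\<nu> + 1 + of_nat n" "\<nu> + 1"] by simp
    then have g1: "1 \<le> norm (\<nu> + 1 + of_nat n)" using N of_nat_mono[OF n, where 'a=real] norm_ge_zero[of s] unfolding norm_of_nat by linarith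
    have g2: "2 * norm s \<le> real (Suc n)"
      using N of_nat_mono[OF n, where 'a=real] norm_ge_zero[of "\<nu> + 1"] unfolding of_nat_Suc by linarith
    let ?X = "norm (clifford_coeff \<nu> (Suc n)) * norm s ^ n"
    have "2 * norm s * 1 * ?X \<le> real (Suc n) * norm (\<nu> + 1 + of_nat n) * ?X"
      by (intro mult_right_mono mult_mono g1 g2) auto
    also have "\<dots> = norm (of_nat (Suc n) * (\<nu> + 1 + of_nat n) * clifford_coeff \<nu> (Suc n)) * norm s ^ n"
      by (simp only: norm_mult norm_of_nat)
    also have "\<dots> = norm (clifford_coeff \<nu> n) * norm s ^ n"
      by (simp only: clifford_coeff_Suc norm_minus_cancel)
    finally show "norm (clifford_coeff \<nu> (Suc n) * s ^ Suc n) \<le> 1/2 * norm (clifford_coeff \<nu> n * s ^ n)"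
      by (simp add: norm_mult norm_power mult_ac)
  qed simp
qed

lemma summable_norm_clifford: "summable (\<lambda>k. norm (clifford_coeff \<nu> k * s ^ k))"
  by (rule powser_insidea[of _ "of_real (norm s + 1)"])
    (auto simp: summable_clifford simp del: of_real_add)

lemma has_field_derivative_clifford:
  "(clifford \<nu> has_field_derivative - clifford (\<nu> + 1) s) (at s)"
proof -
  have "((\<lambda>x. \<Sum>n. clifford_coeff \<nu> n * x ^ n) has_field_derivative
      (\<Sum>n. diffs (clifford_coeff \<nu>) n * s ^ n)) (at s)"
    by (rule termdiffs_strong_converges_everywhere[OF summable_clifford])
  moreover have "diffs (clifford_coeff \<nu>) n * s ^ n = - (clifford_coeff (\<nu> + 1) n * s ^ n)" for n
    unfolding diffs_def clifford_coeff_shift by simp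
  ultimately show ?thesis
    using suminf_minus[OF summable_clifford[of "\<nu>+1" s]] unfolding clifford_def[abs_def] by simp
qed

text \<open>
  Together with the derivative rule this is the differential equation
  \<open>s g'' + (\<nu> + 1) g' + g = 0\<close> for \<open>g = clifford \<nu>\<close>.
\<close>

lemma clifford_recurrence:
  "s * clifford (\<nu> + 2) s = (\<nu> + 1) * clifford (\<nu> + 1) s - clifford \<nu> s"
proof -
  let ?c = clifford_coeff
  have coeff: "?c \<nu> n = (\<nu> + 1) * ?c (\<nu> + 1) n + of_nat n * ?c (\<nu> + 1) n" for n
  proof -
    have *: "\<nu> + 1 + 1 + of_nat n = \<nu> + 1 + of_nat n + 1" by simp
    have "(\<nu> + 1 + of_nat n) * ?c (\<nu> + 1) n = ?c \<nu> n"
      using rGamma_plus1[of "\<nu> + 1 + of_nat n"] unfolding clifford_coeff_def *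
      by (simp add: divide_simps)
    then show ?thesis by (simp add: algebra_simps)
  qed
  have sums: "(\<lambda>n. (\<nu> + 1) * (?c (\<nu> + 1) n * s ^ n) - ?c \<nu> n * s ^ n)
      sums ((\<nu> + 1) * clifford (\<nu> + 1) s - clifford \<nu> s)"
    unfolding clifford_def by (intro sums_diff sums_mult summable_sums summable_clifford)
  have eq: "(\<nu> + 1) * (?c (\<nu> + 1) n * s ^ n) - ?c \<nu> n * s ^ n = - of_nat n * ?c (\<nu> + 1) n * s ^ n" for n
    by (subst coeff) (simp add: algebra_simps)
  have "(\<lambda>n. - of_nat (Suc n) * ?c (\<nu> + 1) (Suc n) * s ^ Suc n)
      sums ((\<nu> + 1) * clifford (\<nu> + 1) s - clifford \<nu> s)"
    using sums unfolding eq by (subst sums_Suc_iff) simp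
  also have "(\<lambda>n. - of_nat (Suc n) * ?c (\<nu> + 1) (Suc n) * s ^ Suc n)
      = (\<lambda>n. s * (?c (\<nu> + 2) n * s ^ n))"
  proof
    fix n
    have "- of_nat (Suc n) * ?c (\<nu> + 1) (Suc n) = ?c (\<nu> + 2) n"
      using clifford_coeff_shift[of n "\<nu> + 1"] by (simp add: add.assoc del: of_nat_Suc)
    then show "- of_nat (Suc n) * ?c (\<nu> + 1) (Suc n) * s ^ Suc n = s * (?c (\<nu> + 2) n * s ^ n)"
      by (simp only: power_Suc mult_ac)
  qed
  finally have "(\<lambda>n. s * (?c (\<nu> + 2) n * s ^ n)) sums ((\<nu> + 1) * clifford (\<nu> + 1) s - clifford \<nu> s)" .
  moreover have "(\<lambda>n. s * (?c (\<nu> + 2) n * s ^ n)) sums (s * clifford (\<nu> + 2) s)"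
    unfolding clifford_def by (intro sums_mult summable_sums summable_clifford)
  ultimately show ?thesis by (rule sums_unique2[symmetric])
qed

lemma continuous_on_clifford [continuous_intros]:
  assumes "continuous_on A f"
  shows "continuous_on A (\<lambda>x. clifford \<nu> (f x))"
proof -
  have "continuous_on UNIV (clifford \<nu>)"
    by (rule continuous_at_imp_continuous_on) (blast intro: DERIV_isCont has_field_derivative_clifford)
  then show ?thesis
    using assms by (rule continuous_on_compose2) auto
qed

lemma bessel_J_eq_clifford: "bessel_J \<nu> z = (z / 2) powr \<nu> * clifford \<nu> ((z / 2)\<^sup>2)"
proof -
  have "(-1) ^ k * (z / 2) ^ (2 * k) / (fact k * Gamma (\<nu> + 1 + of_nat k))
      = clifford_coeff \<nu> k * ((z / 2)\<^sup>2) ^ k" for k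
  proof -
    have "u * v / (w * x) = u * inverse x / w * v" for u v w x :: complex
      by (simp add: divide_inverse mult_ac)
    then show ?thesis
      unfolding clifford_coeff_def rGamma_inverse_Gamma power_mult .
  qed
  then show ?thesis by (simp add: bessel_J_def clifford_def)
qed

section \<open>Polynomial growth on the positive axis\<close>

text \<open>
  With \<open>g = clifford \<nu>\<close> this is \<open>\<bar>g\<bar>\<^sup>2 + s \<bar>g'\<bar>\<^sup>2\<close>, the energy of the oscillation that the differential
  equation describes.
\<close>

definition clifford_energy :: "complex \<Rightarrow> real \<Rightarrow> real" where
  "clifford_energy \<nu> s = (norm (clifford \<nu> (of_real s)))\<^sup>2 + s * (norm (clifford (\<nu> + 1) (of_real s)))\<^sup>2"

text \<open>
  The mixed terms \<open>g \<bullet> g'\<close> cancel by the differential equation, which leaves a multiple of \<open>\<bar>g'\<bar>\<^sup>2\<close>.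
  The imaginary part of \<open>\<nu>\<close> drops out because \<open>i g'\<close> is orthogonal to \<open>g'\<close>.
\<close>

lemma clifford_energy_derivative:
  "(clifford_energy \<nu> has_real_derivative - (1 + 2 * Re \<nu>) * (norm (clifford (\<nu> + 1) (of_real s)))\<^sup>2) (at s)"
proof -
  define R I where "R \<alpha> s = Re (clifford \<alpha> (of_real s))" and "I \<alpha> s = Im (clifford \<alpha> (of_real s))"
    for \<alpha> and s :: real
  have D: "((\<lambda>s. clifford \<alpha> (of_real s)) has_vector_derivative - clifford (\<alpha> + 1) (of_real s)) (at s)"
    for \<alpha>
    using field_vector_diff_chain_at[OF has_vector_derivative_of_real[OF DERIV_ident] has_field_derivative_clifford]
    by (simp add: o_def has_vector_derivative_def)
  have DR: "((\<lambda>s. R \<alpha> s) has_real_derivative - R (\<alpha> + 1) s) (at s)"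
   and DI: "((\<lambda>s. I \<alpha> s) has_real_derivative - I (\<alpha> + 1) s) (at s)" for \<alpha>
    using bounded_linear.has_vector_derivative[OF bounded_linear_Re D[of \<alpha>]]
      bounded_linear.has_vector_derivative[OF bounded_linear_Im D[of \<alpha>]]
    by (simp_all add: has_real_derivative_iff_has_vector_derivative R_def I_def)
  note rec = clifford_recurrence[of "of_real s" \<nu>]
  have recR: "s * R (\<nu> + 2) s = (Re \<nu> + 1) * R (\<nu> + 1) s - Im \<nu> * I (\<nu> + 1) s - R \<nu> s"
   and recI: "s * I (\<nu> + 2) s = (Re \<nu> + 1) * I (\<nu> + 1) s + Im \<nu> * R (\<nu> + 1) s - I \<nu> s"
    using arg_cong[OF rec, of Re] arg_cong[OF rec, of Im] by (simp_all add: algebra_simps R_def I_def)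
  have "((\<lambda>s. ((R \<nu> s)\<^sup>2 + (I \<nu> s)\<^sup>2) + s * ((R (\<nu> + 1) s)\<^sup>2 + (I (\<nu> + 1) s)\<^sup>2))
      has_real_derivative
        - 2 * (R \<nu> s * R (\<nu> + 1) s + I \<nu> s * I (\<nu> + 1) s)
        + ((R (\<nu> + 1) s)\<^sup>2 + (I (\<nu> + 1) s)\<^sup>2)
        - 2 * (R (\<nu> + 1) s * (s * R (\<nu> + 2) s) + I (\<nu> + 1) s * (s * I (\<nu> + 2) s))) (at s)"
    by (rule derivative_eq_intros DR DI refl)+ (simp add: algebra_simps)
  also have "- 2 * (R \<nu> s * R (\<nu> + 1) s + I \<nu> s * I (\<nu> + 1) s)
        + ((R (\<nu> + 1) s)\<^sup>2 + (I (\<nu> + 1) s)\<^sup>2)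
        - 2 * (R (\<nu> + 1) s * (s * R (\<nu> + 2) s) + I (\<nu> + 1) s * (s * I (\<nu> + 2) s))
      = - (1 + 2 * Re \<nu>) * ((R (\<nu> + 1) s)\<^sup>2 + (I (\<nu> + 1) s)\<^sup>2)"
    unfolding recR recI by (simp add: algebra_simps power2_eq_square)
  finally show ?thesis
    unfolding clifford_energy_def cmod_power2 R_def I_def .
qed

text \<open>
  By the preceding identity the derivative of the energy \<open>E\<close> is at most \<open>(2 * L / s) * E\<close>; hence
  \<open>E s / s ^ (2 * L)\<close> is nonincreasing.
\<close>

lemma clifford_energy_growth:
  assumes L: "\<bar>1 + 2 * Re \<nu>\<bar> \<le> real (2 * L)" "L > 0" and s: "1 \<le> s"
  shows "clifford_energy \<nu> s \<le> clifford_energy \<nu> 1 * s ^ (2 * L)"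
proof -
  have "clifford_energy \<nu> s / s ^ (2 * L) \<le> clifford_energy \<nu> 1 / 1 ^ (2 * L)"
  proof (rule DERIV_nonpos_imp_nonincreasing[OF s])
    fix x :: real assume x: "1 \<le> x" "x \<le> s"
    let ?q = "(norm (clifford (\<nu> + 1) (of_real x)))\<^sup>2"
    have "- (1 + 2 * Re \<nu>) * ?q * x \<le> \<bar>1 + 2 * Re \<nu>\<bar> * (x * ?q)"
    proof -
      have "- (1 + 2 * Re \<nu>) * (x * ?q) \<le> \<bar>1 + 2 * Re \<nu>\<bar> * (x * ?q)"
        using x by (intro mult_right_mono) auto
      then show ?thesis by (simp only: mult_ac)
    qed
    also have "\<dots> \<le> (2 * L) * clifford_energy \<nu> x"
    proof (rule mult_mono)
      show "\<bar>1 + 2 * Re \<nu>\<bar> \<le> real (2 * L)" using L by simp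
      show "x * ?q \<le> clifford_energy \<nu> x" by (simp add: clifford_energy_def)
    qed (use x in auto)
    finally have "(- (1 + 2 * Re \<nu>) * ?q * x - (2 * L) * clifford_energy \<nu> x) / (x ^ (2 * L) * x) \<le> 0"
      using x by (intro divide_nonpos_nonneg) auto
    moreover have "((\<lambda>x. clifford_energy \<nu> x / x ^ (2 * L)) has_real_derivative
        (- (1 + 2 * Re \<nu>) * ?q * x - (2 * L) * clifford_energy \<nu> x) / (x ^ (2 * L) * x)) (at x)"
    proof -
      define P where "P = x ^ (2 * L - 1)"
      have P: "x ^ (2 * L) = x * P"
        using L unfolding P_def by (cases L) auto
      have P0: "P \<noteq> 0" "x \<noteq> 0" using x by (auto simp: P_def)
      have q: "(d * (x * P) - e * (k * P)) / (x * P * (x * P)) = (d * x - k * e) / (x * P * x)" for d e k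
        using P0 by (simp add: divide_simps) (simp add: algebra_simps)
      have "((\<lambda>x. x ^ (2 * L)) has_real_derivative real (2 * L) * P) (at x)"
        using DERIV_pow[of "2 * L" x UNIV] by (simp add: P_def)
      from DERIV_divide[OF clifford_energy_derivative[of \<nu>] this] have
        "x * P \<noteq> 0 \<Longrightarrow> ?thesis" unfolding P q .
      then show ?thesis using P0 by (metis no_zero_divisors)
    qed
    ultimately show "\<exists>y. ((\<lambda>x. clifford_energy \<nu> x / x ^ (2 * L)) has_real_derivative y) (at x) \<and> y \<le> 0" by blast
  qed
  then show ?thesis using s by (simp add: pos_divide_le_eq)
qed

text \<open>
  Estimating the power series term by term only gives growth like \<open>exp (2 * sqrt s)\<close>, which in the integral below
  becomes \<open>exp (x * y)\<close> and is not controlled by \<open>exp (- a * x powr \<xi>)\<close> when \<open>\<xi> < 1\<close>. The energy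
  takes account of the cancellation on the positive axis.
\<close>

lemma clifford_polynomial_bound:
  obtains C :: real and L :: nat where "C > 0"
    "\<And>s. s \<ge> 0 \<Longrightarrow> norm (clifford \<nu> (of_real s)) \<le> C * (1 + s ^ L)"
proof -
  obtain L :: nat where L: "real L > \<bar>1 + 2 * Re \<nu>\<bar>" using reals_Archimedean2 by blast
  let ?E = "clifford_energy \<nu>"
  have E0: "(norm (clifford \<nu> (of_real s)))\<^sup>2 \<le> ?E s" if "s \<ge> 0" for s
    using that by (simp add: clifford_energy_def)
  have large: "norm (clifford \<nu> (of_real s)) \<le> sqrt (?E 1) * s ^ L" if s: "1 \<le> s" for s
  proof -
    have "(norm (clifford \<nu> (of_real s)))\<^sup>2 \<le> ?E 1 * s ^ (2 * L)"
    proof -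
      have "?E s \<le> ?E 1 * s ^ (2 * L)"
        using L s by (intro clifford_energy_growth) auto
      then show ?thesis using E0[of s] s by simp
    qed
    then have "norm (clifford \<nu> (of_real s)) \<le> sqrt (?E 1 * s ^ (2 * L))"
      by (rule real_le_rsqrt)
    also have "s ^ (2 * L) = (s ^ L)\<^sup>2" by (rule power_even_eq)
    also have "sqrt (?E 1 * (s ^ L)\<^sup>2) = sqrt (?E 1) * s ^ L"
      using s by (simp add: real_sqrt_mult)
    finally show ?thesis .
  qed
  have "compact ((\<lambda>s. clifford \<nu> (of_real s)) ` {0..1::real})"
    by (intro compact_continuous_image continuous_intros) auto
  then have "bounded ((\<lambda>s. clifford \<nu> (of_real s)) ` {0..1::real})" by (rule compact_imp_bounded)
  then obtain B where B: "B > 0" "\<And>s. s \<in> {0..1} \<Longrightarrow> norm (clifford \<nu> (of_real s)) \<le> B"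
    unfolding bounded_pos ball_simps by blast
  have E1: "0 \<le> sqrt (?E 1)" by (simp add: clifford_energy_def)
  show ?thesis
  proof (rule that[of "B + sqrt (?E 1)" L])
    fix s :: real assume s: "s \<ge> 0"
    have "norm (clifford \<nu> (of_real s)) \<le> B + sqrt (?E 1) * s ^ L"
    proof (cases "1 \<le> s")
      case True
      then show ?thesis using large[of s] B(1) by simp
    next
      case False
      then have "norm (clifford \<nu> (of_real s)) \<le> B" using B(2)[of s] s by simp
      moreover have "0 \<le> sqrt (?E 1) * s ^ L" using E1 s by simp
      ultimately show ?thesis by simp
    qed
    also have "\<dots> \<le> (B + sqrt (?E 1)) * (1 + s ^ L)"
    proof -
      have "0 \<le> B * s ^ L" using B(1) s by simp
      then show ?thesis using E1 by (simp only: distrib_left distrib_right mult_1_right)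
    qed
    finally show "norm (clifford \<nu> (of_real s)) \<le> (B + sqrt (?E 1)) * (1 + s ^ L)" .
  next
    show "B + sqrt (?E 1) > 0" using B(1) E1 by (rule add_pos_nonneg)
  qed
qed

section \<open>Gamma integrals with a stretched exponential\<close>

lemma of_real_powr_eq_exp:
  fixes s :: complex and x :: real
  assumes "x > 0"
  shows "of_real x powr s = exp (s * of_real (ln x))"
  using assms by (simp add: powr_def flip: Ln_of_real)

lemma continuous_on_of_real_powr [continuous_intros]:
  fixes p :: complex
  shows "continuous_on {0<..} (\<lambda>x::real. of_real x powr p)"
proof -
  have "continuous_on {0<..} (\<lambda>x::real. exp (p * of_real (ln x)))"
    by (intro continuous_intros) auto
  then show ?thesis
    by (rule continuous_on_eq) (simp add: of_real_powr_eq_exp)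
qed

text \<open>
  The substitution \<open>t = a * x powr \<xi>\<close> in Euler's integral for \<open>\<Gamma>(s)\<close>.
\<close>

lemma stretched_Gamma_integral:
  fixes p :: complex and a \<xi> :: real
  assumes "a > 0" "\<xi> > 0" and p: "Re p > - 1"
  defines "s \<equiv> (p + 1) / of_real \<xi>"
  defines "F \<equiv> (\<lambda>x::real. of_real x powr p * of_real (exp (- a * x powr \<xi>)))"
  shows "set_integrable lborel {0<..} F"
    and "(LBINT x:{0<..}. F x) = Gamma s / (of_real \<xi> * of_real a powr s)"
proof -
  define g where "g x = a * x powr \<xi>" for x :: real
  define h where "h x = a * (\<xi> * x powr (\<xi> - 1))" for x :: real
  define f where "f t = of_real t powr (s - 1) / of_real (exp t)" for t :: real
  define K where "K = of_real \<xi> * of_real a powr s"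
  have K: "K \<noteq> 0" using assms by (simp add: K_def)
  have s: "Re s > 0" using assms by (simp add: s_def)
  have inv: "(g x / a) powr (1 / \<xi>) = x" if "x > 0" for x
    using that assms by (simp add: g_def powr_powr)
  have inv': "g ((t / a) powr (1 / \<xi>)) = t" if "t > 0" for t
    using that assms by (simp add: g_def powr_powr)
  have inj: "inj_on g {0<..}"
    by (rule inj_on_inverseI[of _ "\<lambda>t. (t / a) powr (1 / \<xi>)"]) (simp add: inv)
  have img: "g ` {0<..} = {0<..}"
  proof (intro equalityI subsetI)
    fix t :: real assume "t \<in> {0<..}"
    then show "t \<in> g ` {0<..}"
      using assms by (intro image_eqI[of _ _ "(t / a) powr (1 / \<xi>)"]) (auto simp: inv')
  qed (use assms in \<open>auto simp: g_def\<close>)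
  have der: "(g has_field_derivative h x) (at x within {0<..})" if "x \<in> {0<..}" for x
    unfolding g_def h_def using that
    by (auto intro!: DERIV_subset[OF DERIV_cmult] has_real_derivative_powr)
  have gam: "f absolutely_integrable_on g ` {0<..} \<and> integral (g ` {0<..}) f = Gamma s"
    unfolding img f_def
    using absolutely_integrable_Gamma_integral'[OF s] integral_unique[OF Gamma_integral_complex'[OF s]] by blast
  have sub: "(\<lambda>x. \<bar>h x\<bar> *\<^sub>R f (g x)) absolutely_integrable_on {0<..}
      \<and> integral {0<..} (\<lambda>x. \<bar>h x\<bar> *\<^sub>R f (g x)) = Gamma s"
    using has_absolute_integral_change_of_variables_real[of "{0<..}" g h f "Gamma s"] der inj gam by auto
  have eq: "\<bar>h x\<bar> *\<^sub>R f (g x) = K * F x" if "x \<in> {0<..}" for x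
  proof -
    have x: "x > 0" using that by simp
    have gx: "g x > 0" using x assms by (simp add: g_def)
    have lg: "ln (g x) = ln a + \<xi> * ln x" using x assms by (simp add: g_def ln_mult ln_powr)
    have hx: "\<bar>h x\<bar> = \<xi> * exp (ln a + (\<xi> - 1) * ln x)"
      using x assms by (simp add: h_def exp_add powr_def)
    have pe: "p = of_real \<xi> * s - 1" using assms by (simp add: s_def)
    have e: "of_real (ln a + (\<xi> - 1) * ln x) + (s - 1) * of_real (ln a + \<xi> * ln x)
        = s * of_real (ln a) + p * of_real (ln x)"
      unfolding pe by (simp add: algebra_simps)
    have "\<bar>h x\<bar> *\<^sub>R f (g x) = of_real \<xi> * (exp (of_real (ln a + (\<xi> - 1) * ln x))
        * exp ((s - 1) * of_real (ln a + \<xi> * ln x))) * of_real (exp (- g x))"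
      unfolding f_def of_real_powr_eq_exp[OF gx] lg hx
      by (simp only: scaleR_conv_of_real of_real_mult exp_of_real exp_minus divide_inverse mult_ac of_real_inverse)
    also have "\<dots> = of_real \<xi> * (of_real a powr s * of_real x powr p) * of_real (exp (- g x))"
      unfolding exp_add[symmetric] e using x assms(1) by (simp add: exp_add of_real_powr_eq_exp)
    finally show ?thesis by (simp add: K_def F_def g_def mult_ac)
  qed
  have abs: "(\<lambda>x. K * F x) absolutely_integrable_on {0<..}"
    using sub eq by (subst (asm) set_integrable_cong[OF refl refl eq]) auto
  have int: "integral {0<..} (\<lambda>x. K * F x) = Gamma s"
    using sub by (subst integral_cong[OF eq[symmetric]]) auto
  have meas: "(\<lambda>x. indicator {0<..} x *\<^sub>R F x) \<in> borel_measurable borel"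
    unfolding F_def using assms(1,2)
    by (intro borel_measurable_continuous_on_indicator continuous_intros) auto
  have absF: "set_integrable lebesgue {0<..} F"
    using set_integrable_mult_right[of "1/K" lebesgue "{0<..}" "\<lambda>x. K * F x"] abs K by simp
  then show *: "set_integrable lborel {0<..} F"
    using meas unfolding set_integrable_def
    by (subst (asm) integrable_completion) auto
  have "K * (LBINT x:{0<..}. F x) = Gamma s"
    using int set_borel_integral_eq_integral[OF *] by simp
  then show "(LBINT x:{0<..}. F x) = Gamma s / K" using K by (simp add: field_simps)
qed

text \<open>
  The modulus of \<open>x powr p\<close> is \<open>x powr Re p\<close>, so this is the same integral at a real exponent.
\<close>

corollary stretched_Gamma_integral_norm:
  fixes p :: complex and a \<xi> :: real
  assumes "a > 0" "\<xi> > 0" and p: "Re p > - 1"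
  defines "s \<equiv> (p + 1) / of_real \<xi>"
  shows "(LBINT x:{0<..}. norm (of_real x powr p * of_real (exp (- a * x powr \<xi>)) :: complex))
    = Gamma (Re s) / (\<xi> * a powr Re s)"
proof -
  have "complex_of_real (LBINT x:{0<..}. norm (of_real x powr p * of_real (exp (- a * x powr \<xi>)) :: complex))
      = (LBINT x:{0<..}. complex_of_real (norm (of_real x powr p * of_real (exp (- a * x powr \<xi>)) :: complex)))"
    by (rule set_integral_complex_of_real[symmetric])
  also have "\<dots> = (LBINT x:{0<..}. of_real x powr of_real (Re p) * of_real (exp (- a * x powr \<xi>)))"
    by (rule set_lebesgue_integral_cong) (auto simp: norm_mult norm_powr_real_powr powr_of_real)
  also have "\<dots> = Gamma (of_real (Re s)) / (of_real \<xi> * of_real a powr of_real (Re s))"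
  proof -
    have "complex_of_real (Re s) = (of_real (Re p) + 1) / of_real \<xi>" by (simp add: s_def)
    then show ?thesis using stretched_Gamma_integral(2)[of a \<xi> "of_real (Re p)"] assms(1,2) p by simp
  qed
  also have "\<dots> = complex_of_real (Gamma (Re s) / (\<xi> * a powr Re s))"
    using assms(1) Gamma_complex_of_real[of "Re s"] by (simp add: powr_of_real)
  finally show ?thesis by (simp only: of_real_eq_iff)
qed

section \<open>Termwise integration\<close>

text \<open>
  Termwise integration of \<open>F 1\<close> cannot rest on absolute convergence: for \<open>\<xi> = 1\<close> the point of
  evaluation may lie on the circle of convergence. It is therefore carried out for \<open>F u\<close> with
  \<open>0 < u < 1\<close>, where the boundedness of \<open>c\<close> and the geometric factor \<open>u ^ k\<close> suffice. The limit \<open>u \<rightarrow> 1\<close>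
  is taken by dominated convergence in the integral and by Abel's theorem in the series.
\<close>

lemma clifford_transform:
  fixes p \<nu> :: complex and a b \<xi> :: real
  assumes pos: "a > 0" "\<xi> > 0" "b > 0" and p: "Re p > - 1"
  defines "F \<equiv> (\<lambda>t x. of_real x powr p * of_real (exp (- a * x powr \<xi>)) * clifford \<nu> (of_real (t * (b * x\<^sup>2))))"
  defines "s \<equiv> (\<lambda>k::nat. (p + 1) / of_real \<xi> + of_nat k * of_real (2 / \<xi>))"
  defines "c \<equiv> (\<lambda>k. clifford_coeff \<nu> k * of_real b ^ k * (Gamma (s k) / (of_real \<xi> * of_real a powr s k)))"
  shows "set_integrable lborel {0<..} (F 1)"
    and "summable c \<Longrightarrow> (LBINT x:{0<..}. F 1 x) = suminf c"
proof -
  define W where "W k x = of_real x powr (p + of_nat (2 * k)) * of_real (exp (- a * x powr \<xi>))"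
    for k :: nat and x :: real
  have pk: "Re (p + of_nat (2 * k)) > - 1" for k using p by simp
  have sk: "(p + of_nat (2 * k) + 1) / of_real \<xi> = s k" for k
    using pos by (simp add: s_def field_simps)
  have W_int: "set_integrable lborel {0<..} (W k)" for k
    unfolding W_def by (rule stretched_Gamma_integral(1)[OF pos(1,2) pk])
  have W_integral: "(LBINT x:{0<..}. W k x) = Gamma (s k) / (of_real \<xi> * of_real a powr s k)" for k
    unfolding W_def stretched_Gamma_integral(2)[OF pos(1,2) pk] sk ..
  have W_norm: "(LBINT x:{0<..}. norm (W k x)) = Gamma (Re (s k)) / (\<xi> * a powr Re (s k))" for k
    unfolding W_def stretched_Gamma_integral_norm[OF pos(1,2) pk] sk ..
  have W_power: "W k x = W 0 x * of_real (x\<^sup>2) ^ k" if "x > 0" for k x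
  proof -
    have "complex_of_real x powr of_nat (2 * k) = of_real x ^ (2 * k)"
      using that by (intro powr_nat') auto
    then have "complex_of_real x powr (p + of_nat (2 * k)) = of_real x powr p * of_real (x\<^sup>2) ^ k"
      by (simp only: powr_add power_mult of_real_power)
    then show ?thesis by (simp add: W_def mult_ac)
  qed
  have F_W: "F t x = W 0 x * clifford \<nu> (of_real (t * (b * x\<^sup>2)))" for t x
    by (simp add: F_def W_def)
  obtain C L where C: "C > 0"
    "\<And>u. u \<ge> 0 \<Longrightarrow> norm (clifford \<nu> (of_real u)) \<le> C * (1 + u ^ L)"
    using clifford_polynomial_bound[of \<nu>] by blast
  \<comment> \<open>An integrable majorant of all \<open>F t\<close> with \<open>0 \<le> t \<le> 1\<close>: since \<open>\<bar>W L x\<bar> = \<bar>W 0 x\<bar> * x ^ (2 * L)\<close>, it is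
    \<open>\<bar>W 0 x\<bar>\<close> times the polynomial bound of \<open>clifford \<nu>\<close> at \<open>b * x\<^sup>2\<close>.\<close>
  define D where "D x = C * norm (W 0 x) + C * b ^ L * norm (W L x)" for x
  have D_int: "set_integrable lborel {0<..} D"
    unfolding D_def using set_integrable_norm[OF W_int] by (intro set_integral_add set_integrable_mult_right)
  have F_bound: "norm (F t x) \<le> D x" if "x > 0" "0 \<le> t" "t \<le> 1" for t x
  proof -
    have "(t * (b * x\<^sup>2)) ^ L \<le> (1 * (b * x\<^sup>2)) ^ L"
      using that pos by (intro power_mono mult_right_mono) auto
    then have "C * (1 + (t * (b * x\<^sup>2)) ^ L) \<le> C * (1 + (b * x\<^sup>2) ^ L)"
      using C(1) by simp
    moreover have "norm (clifford \<nu> (of_real (t * (b * x\<^sup>2)))) \<le> C * (1 + (t * (b * x\<^sup>2)) ^ L)"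
      using that pos by (intro C(2)) auto
    ultimately have "norm (clifford \<nu> (of_real (t * (b * x\<^sup>2)))) \<le> C * (1 + (b * x\<^sup>2) ^ L)"
      by simp
    then have "norm (F t x) \<le> norm (W 0 x) * (C * (1 + (b * x\<^sup>2) ^ L))"
      unfolding F_W norm_mult by (intro mult_left_mono) auto
    also have "\<dots> = D x"
      unfolding D_def W_power[OF that(1), of L] by (simp add: norm_mult norm_power power_mult_distrib algebra_simps)
    finally show ?thesis .
  qed
  have F_meas: "(\<lambda>x. indicator {0<..} x *\<^sub>R F t x) \<in> borel_measurable borel" for t
    unfolding F_def
    by (intro borel_measurable_continuous_on_indicator continuous_intros) auto
  show F_int: "set_integrable lborel {0<..} (F 1)"
    unfolding set_integrable_def
  proof (rule Bochner_Integration.integrable_bound[OF D_int[unfolded set_integrable_def]])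
    show "(\<lambda>x. indicator {0<..} x *\<^sub>R F 1 x) \<in> borel_measurable lborel"
      using F_meas[of 1] by simp
    show "AE x in lborel. norm (indicator {0<..} x *\<^sub>R F 1 x) \<le> norm (indicator {0<..} x *\<^sub>R D x)"
      using F_bound[of _ 1] by (intro AE_I2) (auto simp: indicator_def intro: order_trans[OF _ abs_ge_self])
  qed

  assume sum: "summable c"
  define t where "t m = 1 - 1 / real (m + 2)" for m
  have t: "0 < t m" "t m < 1" for m by (auto simp: t_def field_simps)
  have "t \<longlonglongrightarrow> 1 - 0"
    unfolding t_def by (intro tendsto_diff tendsto_const LIMSEQ_ignore_initial_segment lim_1_over_n)
  then have t_lim: "t \<longlonglongrightarrow> 1" by simp

  define M where "M = Gamma (Re (s 0)) / norm (Gamma (s 0))"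
  have s0: "Re (s 0) > 0" using pos p by (simp add: s_def)
  then have Gamma_s0: "norm (Gamma (s 0)) > 0"
    by (auto simp: Gamma_eq_zero_iff elim!: nonpos_Ints_cases)
  have M: "M \<ge> 0" using s0 by (simp add: M_def Gamma_real_nonneg)
  have Gamma_bound: "Gamma (Re (s k)) \<le> M * norm (Gamma (s k))" for k
  proof -
    have "Complex (Re (s 0)) (Im (s 0)) = s 0" "Complex (Re (s k)) (Im (s 0)) = s k"
      by (auto simp: s_def complex_eq_iff)
    moreover have "Re (s 0) \<le> Re (s k)" using pos by (simp add: s_def)
    ultimately show ?thesis
      using norm_Gamma_ratio_mono[OF s0, of "Re (s k)" "Im (s 0)"] Gamma_s0
      by (simp add: M_def field_simps)
  qed
  have W_norm_bound: "(LBINT x:{0<..}. norm (W k x))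
      \<le> M * norm (Gamma (s k) / (of_real \<xi> * of_real a powr s k))" for k
    unfolding W_norm using Gamma_bound[of k] pos
    by (simp add: norm_divide norm_mult norm_powr_real_powr divide_right_mono)
  obtain B where B: "\<And>k. norm (c k) \<le> B"
    using summable_LIMSEQ_zero[OF sum] by (meson BseqE convergentI convergent_imp_Bseq)
  have below: "(LBINT x:{0<..}. F u x) = (\<Sum>k. c k * of_real u ^ k)" if u: "0 < u" "u < 1" for u :: real
  proof -
    define f where "f k x = indicator {0<..} x *\<^sub>R (clifford_coeff \<nu> k * of_real (u * b) ^ k * W k x)"
      for k and x :: real
    have f_eq: "f k x = indicator {0<..} x *\<^sub>R (W 0 x * (clifford_coeff \<nu> k * of_real (u * (b * x\<^sup>2)) ^ k))"
      for k x
      by (cases "x > 0") (simp_all add: W_power[of x k] f_def power_mult_distrib mult_ac)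
    have f_int: "integrable lborel (f k)" for k
      using set_integrable_mult_right[OF W_int[of k], of "clifford_coeff \<nu> k * of_real (u * b) ^ k"]
      unfolding f_def set_integrable_def .
    have f_integral: "(LBINT x. f k x) = c k * of_real u ^ k" for k
    proof -
      have "(LBINT x. f k x) = (LBINT x:{0<..}. clifford_coeff \<nu> k * of_real (u * b) ^ k * W k x)"
        unfolding f_def set_lebesgue_integral_def ..
      also have "\<dots> = clifford_coeff \<nu> k * of_real (u * b) ^ k * (Gamma (s k) / (of_real \<xi> * of_real a powr s k))"
        by (simp only: set_integral_mult_right W_integral)
      finally show ?thesis by (simp add: c_def power_mult_distrib mult_ac)
    qed
    have f_norm: "(LBINT x. norm (f k x)) \<le> M * B * u ^ k" for k
    proof -
      have "(LBINT x. norm (f k x)) = (LBINT x:{0<..}. norm (clifford_coeff \<nu> k * of_real (u * b) ^ k) * norm (W k x))"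
        unfolding f_def set_lebesgue_integral_def
        by (intro Bochner_Integration.integral_cong) (auto simp: norm_mult)
      also have "\<dots> = norm (clifford_coeff \<nu> k * of_real (u * b) ^ k) * (LBINT x:{0<..}. norm (W k x))"
        by (rule set_integral_mult_right)
      also have "\<dots> \<le> norm (clifford_coeff \<nu> k * of_real (u * b) ^ k)
          * (M * norm (Gamma (s k) / (of_real \<xi> * of_real a powr s k)))"
        by (intro mult_left_mono W_norm_bound) auto
      also have "\<dots> = M * norm (c k) * u ^ k"
        using u pos by (simp add: c_def norm_mult norm_divide norm_power power_mult_distrib)
      also have "\<dots> \<le> M * B * u ^ k"
        using u M by (intro mult_right_mono mult_left_mono B) auto
      finally show ?thesis .
    qed
    have "(\<lambda>k. LBINT x. f k x) sums (LBINT x. \<Sum>k. f k x)"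
    proof (rule sums_integral[OF f_int])
      show "AE x in lborel. summable (\<lambda>k. norm (f k x))"
        unfolding f_eq norm_scaleR norm_mult[of "W 0 _"]
        by (intro AE_I2 summable_mult summable_norm_clifford)
      show "summable (\<lambda>k. LBINT x. norm (f k x))"
      proof (rule summable_comparison_test)
        show "\<exists>N. \<forall>k\<ge>N. norm (LBINT x. norm (f k x)) \<le> M * B * u ^ k"
          using f_norm by (simp add: integral_nonneg_AE)
        show "summable (\<lambda>k. M * B * u ^ k)"
          using u by (intro summable_mult summable_geometric) auto
      qed
    qed
    moreover have "(\<Sum>k. f k x) = indicator {0<..} x *\<^sub>R F u x" for x
    proof -
      have "(\<lambda>k. f k x) sums (indicator {0<..} x *\<^sub>R (W 0 x * clifford \<nu> (of_real (u * (b * x\<^sup>2)))))"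
        unfolding f_eq clifford_def by (intro sums_scaleR_right sums_mult summable_sums summable_clifford)
      then show ?thesis by (simp add: F_W sums_iff)
    qed
    ultimately show ?thesis
      by (simp add: f_integral set_lebesgue_integral_def sums_iff)
  qed
  have "(\<lambda>m. LBINT x:{0<..}. F (t m) x) \<longlonglongrightarrow> (LBINT x:{0<..}. F 1 x)"
    unfolding set_lebesgue_integral_def
  proof (rule integral_dominated_convergence)
    show "integrable lborel (\<lambda>x. indicator {0<..} x *\<^sub>R D x)"
      using D_int unfolding set_integrable_def .
    show "AE x in lborel. norm (indicator {0<..} x *\<^sub>R F (t m) x) \<le> indicator {0<..} x *\<^sub>R D x" for m
      using F_bound[of _ "t m"] t[of m] by (intro AE_I2) (auto simp: indicator_def)
    have "(\<lambda>m. F (t m) x) \<longlonglongrightarrow> F 1 x" for x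
    proof -
      have "isCont (clifford \<nu>) (of_real (1 * (b * x\<^sup>2)))"
        by (rule DERIV_isCont[OF has_field_derivative_clifford])
      then show ?thesis
        unfolding F_W by (intro tendsto_intros isCont_tendsto_compose[of _ "clifford \<nu>"] t_lim)
    qed
    then show "AE x in lborel. (\<lambda>m. indicator {0<..} x *\<^sub>R F (t m) x) \<longlonglongrightarrow> indicator {0<..} x *\<^sub>R F 1 x"
      by (intro AE_I2 tendsto_intros)
  qed (use F_meas in simp_all)
  moreover have "(\<lambda>m. LBINT x:{0<..}. F (t m) x) \<longlonglongrightarrow> suminf c"
    using Abel_limit[OF sum less_imp_le[OF t(1)] t(2) t_lim] by (simp add: below t)
  ultimately show "(LBINT x:{0<..}. F 1 x) = suminf c"
    by (rule LIMSEQ_unique)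
qed

section \<open>The Bessel transform of a stretched exponential\<close>

theorem theorem1:
  fixes \<xi> a y :: real and \<mu> \<nu> \<sigma> z :: complex and f :: "real \<Rightarrow> complex"
  assumes "\<xi> > 0" and "a > 0" and "y > 0"
    and "Re (\<mu> + \<nu>) > - 1 / 2"
    and "\<sigma> = (2 * \<mu> + 2 * \<nu> + 3) / (2 * of_real \<xi>)"
    and "z = of_real (- (y\<^sup>2 / (4 * a powr (2 / \<xi>))))"
    and "f = (\<lambda>x. of_real x powr \<mu> * of_real (exp (- a * x powr \<xi>)) *
                   of_real (sqrt (x * y)) * bessel_J \<nu> (of_real (x * y)))"
  shows "set_integrable lborel {0<..} f \<and>
         (summable (fox_wright_term [(\<sigma>, 2 / \<xi>)] [(\<nu> + 1, 1)] z) \<longrightarrow>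
           (LBINT x:{0<..}. f x) =
             of_real y powr (\<nu> + 1 / 2) / (2 powr \<nu> * of_real \<xi> * of_real a powr \<sigma>) *
             fox_wright [(\<sigma>, 2 / \<xi>)] [(\<nu> + 1, 1)] z)"
proof -
  \<comment> \<open>Collecting the powers of \<open>x\<close> gives \<open>x powr p\<close>; the remaining constant is \<open>A\<close>, and \<open>K\<close> is the factor
    between \<open>fox_wright_term\<close> and the moment series. The factor 1 in \<open>F\<close> is the scaling parameter of
    \<open>clifford_transform\<close>.\<close>
  define p where "p = \<mu> + \<nu> + 1 / 2"
  define b where "b = y\<^sup>2 / 4"
  define A where "A = of_real y powr (\<nu> + 1 / 2) / (2 powr \<nu> :: complex)"
  define F where "F x = of_real x powr p * of_real (exp (- a * x powr \<xi>)) * clifford \<nu> (of_real (1 * (b * x\<^sup>2)))"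
    for x :: real
  define c where "c k = clifford_coeff \<nu> k * of_real b ^ k *
      (Gamma ((p + 1) / of_real \<xi> + of_nat k * of_real (2 / \<xi>)) /
        (of_real \<xi> * of_real a powr ((p + 1) / of_real \<xi> + of_nat k * of_real (2 / \<xi>))))" for k
  let ?fw = "fox_wright_term [(\<sigma>, 2 / \<xi>)] [(\<nu> + 1, 1)] z"
  define K where "K = 1 / (of_real \<xi> * of_real a powr \<sigma>)"
  have b: "b > 0" using assms(3) by (simp add: b_def)
  have p: "Re p > - 1" using assms(4) by (simp add: p_def)
  have \<sigma>: "\<sigma> = (p + 1) / of_real \<xi>"
    unfolding assms(5) p_def using assms(1) by (simp add: field_simps)
  have A: "A \<noteq> 0" using assms(3) by (simp add: A_def)
  note F_int = clifford_transform(1)[OF assms(2,1) b p, of \<nu>, folded F_def]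
  note F_integral = clifford_transform(2)[OF assms(2,1) b p, of \<nu>, folded F_def, folded c_def]
  have f_eq: "f x = A * F x" if "x \<in> {0<..}" for x
  proof -
    have x: "x > 0" and xy: "x * y / 2 > 0" using that assms(3) by auto
    have l: "ln (x * y / 2) = ln x + ln y - ln 2"
      using x assms(3) by (simp add: ln_mult ln_div)
    have two: "(2 powr \<nu> :: complex) = exp (\<nu> * of_real (ln 2))"
      using of_real_powr_eq_exp[of 2 \<nu>] by simp
    have sq: "sqrt (x * y) = exp ((ln x + ln y) / 2)"
      using x assms(3) by (simp flip: powr_half_sqrt add: powr_def ln_mult)
    have "complex_of_real (x * y) / 2 = of_real (x * y / 2)" by simp
    then have "bessel_J \<nu> (of_real (x * y)) = exp (\<nu> * of_real (ln x + ln y - ln 2)) * clifford \<nu> (of_real (1 * (b * x\<^sup>2)))"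
      unfolding bessel_J_eq_clifford l[symmetric]
      by (simp only: of_real_powr_eq_exp[OF xy]) (simp add: b_def power2_eq_square mult_ac)
    moreover have "of_real x powr \<mu> * of_real (sqrt (x * y)) * exp (\<nu> * of_real (ln x + ln y - ln 2))
        = A * of_real x powr p"
      unfolding A_def two sq of_real_powr_eq_exp[OF x] of_real_powr_eq_exp[OF assms(3)]
        p_def exp_of_real[symmetric]
      by (simp only: divide_inverse exp_minus[symmetric] exp_add[symmetric]) (simp add: algebra_simps add_divide_distrib)
    ultimately have bessel: "of_real x powr \<mu> * of_real (sqrt (x * y)) * bessel_J \<nu> (of_real (x * y))
        = A * of_real x powr p * clifford \<nu> (of_real (1 * (b * x\<^sup>2)))"
      by (simp only: mult.assoc[symmetric])
    have "f x = of_real (exp (- a * x powr \<xi>)) *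
        (of_real x powr \<mu> * of_real (sqrt (x * y)) * bessel_J \<nu> (of_real (x * y)))"
      unfolding assms(7) by (simp only: mult_ac)
    then show ?thesis unfolding bessel F_def by (simp only: mult_ac)
  qed
  have c_eq: "c k = K * ?fw k" for k
  proof -
    have "of_real (a powr (2 / \<xi>)) = exp (of_real (2 / \<xi>) * of_real (ln a) :: complex)"
      using assms(2) by (simp add: powr_def exp_of_real[symmetric])
    then have "of_real a powr (\<sigma> + of_nat k * of_real (2 / \<xi>)) = of_real a powr \<sigma> * of_real (a powr (2 / \<xi>)) ^ k"
      unfolding of_real_powr_eq_exp[OF assms(2)] distrib_right exp_add mult.assoc exp_of_nat_mult by simp
    moreover have "z = (-1) * (of_real b / of_real (a powr (2 / \<xi>)))"
      unfolding assms(6) b_def by simp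
    then have "z ^ k = (-1) ^ k * (of_real b ^ k / of_real (a powr (2 / \<xi>)) ^ k)"
      by (simp only: power_mult_distrib power_divide)
    ultimately show ?thesis
      unfolding c_def \<sigma>[symmetric] K_def fox_wright_term_def clifford_coeff_def rGamma_inverse_Gamma
      by (simp add: divide_inverse inverse_mult_distrib)
  qed
  show ?thesis
  proof (intro conjI impI)
    show "set_integrable lborel {0<..} f"
      using F_int A by (subst set_integrable_cong[OF refl refl f_eq]) auto
    assume "summable ?fw"
    then have sums: "summable c" unfolding c_eq[abs_def] by (rule summable_mult)
    have "(LBINT x:{0<..}. f x) = A * (LBINT x:{0<..}. F x)"
      by (subst set_lebesgue_integral_cong[of _ _ f "\<lambda>x. A * F x"]) (auto simp: f_eq)
    also have "\<dots> = A * (K * suminf ?fw)"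
      using F_integral[OF sums] suminf_mult[OF \<open>summable ?fw\<close>, of K] by (simp add: c_eq[abs_def])
    finally show "(LBINT x:{0<..}. f x) =
        of_real y powr (\<nu> + 1 / 2) / (2 powr \<nu> * of_real \<xi> * of_real a powr \<sigma>) *
        fox_wright [(\<sigma>, 2 / \<xi>)] [(\<nu> + 1, 1)] z"
      by (simp add: fox_wright_def A_def K_def mult_ac)
  qed
qed

end
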